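(* Let $\mathscr{H}$ be a complex Hilbert space, let $T, S \in \mathbb{B}(\mathscr{H})$, and suppose that $M^*_{\omega(T)} = M^*_{\omega(S)}$. Then $T \perp_{\omega B} S$ if and only if $S \perp_{\omega B} T$.
   Context: $\mathbb{B}(\mathscr{H})$ denotes the algebra of all bounded linear operators on the complex Hilbert space $\mathscr{H}$. The numerical radius of $T \in \mathbb{B}(\mathscr{H})$ is $\omega(T) = \sup\{|\langle Tx, x\rangle| : x \in \mathscr{H},\ \|x\| = 1\}$. For $T \in \mathbb{B}(\mathscr{H})$, $M^*_{\omega(T)}$ is the set of all sequences $\{x_n\}$ in $\mathscr{H}$ with $\|x_n\| = 1$ for all $n$ and $\lim_n |\langle Tx_n, x_n\rangle| = \omega(T)$. $T$ is numerical radius Birkhoff orthogonal to $S$, written $T \perp_{\omega B} S$, if $\omega(T + \lambda S) \geq \omega(T)$ for all $\lambda \in \mathbb{C}$. *)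

theory Defs
  imports "HOL-Analysis.Analysis"
begin

class complex_vector = real_vector +
  fixes scaleC :: "complex \<Rightarrow> 'a \<Rightarrow> 'a" (infixr "*\<^sub>C" 75)
  assumes scaleC_add_right: "a *\<^sub>C (x + y) = a *\<^sub>C x + a *\<^sub>C y"
    and scaleC_add_left: "(a + b) *\<^sub>C x = a *\<^sub>C x + b *\<^sub>C x"
    and scaleC_scaleC: "a *\<^sub>C b *\<^sub>C x = (a * b) *\<^sub>C x"
    and scaleC_one: "1 *\<^sub>C x = x"
    and scaleR_scaleC: "r *\<^sub>R x = complex_of_real r *\<^sub>C x"

(* The inner product is linear in the first argument and conjugate-linear in the second.
   The norm, metric and topology are those of real_normed_vector, tied to the inner product
   by norm_eq_sqrt_cinner. *)
class complex_inner = complex_vector + real_normed_vector +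
  fixes cinner :: "'a \<Rightarrow> 'a \<Rightarrow> complex"
  assumes cinner_commute: "cinner x y = cnj (cinner y x)"
    and cinner_add_left: "cinner (x + y) z = cinner x z + cinner y z"
    and cinner_scaleC_left: "cinner (c *\<^sub>C x) y = c * cinner x y"
    and cinner_self_nonneg: "0 \<le> Re (cinner x x)"
    and cinner_eq_zero_iff: "cinner x x = 0 \<longleftrightarrow> x = 0"
    and norm_eq_sqrt_cinner: "norm x = sqrt (Re (cinner x x))"

class complex_hilbert_space = complex_inner + complete_space

instantiation complex :: complex_hilbert_space
begin

definition scaleC_complex :: "complex \<Rightarrow> complex \<Rightarrow> complex"
  where "scaleC_complex c x = c * x"

definition cinner_complex :: "complex \<Rightarrow> complex \<Rightarrow> complex"
  where "cinner_complex x y = x * cnj y"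

instance
  by standard
    (auto simp: scaleC_complex_def cinner_complex_def algebra_simps scaleR_conv_of_real
      cmod_def power2_eq_square)

end

definition bounded_clinear :: "('a::complex_inner \<Rightarrow> 'b::complex_inner) \<Rightarrow> bool"
  where "bounded_clinear T \<longleftrightarrow> bounded_linear T \<and> (\<forall>c x. T (c *\<^sub>C x) = c *\<^sub>C T x)"

(* On the zero space the unit sphere is empty and the value is the unspecified real Sup {}. *)
definition numerical_radius :: "('a::complex_inner \<Rightarrow> 'a) \<Rightarrow> real"
  where "numerical_radius T = (SUP x\<in>{x. norm x = 1}. cmod (cinner (T x) x))"

definition numerical_radius_seqs :: "('a::complex_inner \<Rightarrow> 'a) \<Rightarrow> (nat \<Rightarrow> 'a) set"
  where "numerical_radius_seqs T =
    {x. (\<forall>n. norm (x n) = 1) \<and>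
        (\<lambda>n. cmod (cinner (T (x n)) (x n))) \<longlonglongrightarrow> numerical_radius T}"

definition numerical_radius_Birkhoff_orthogonal ::
    "('a::complex_inner \<Rightarrow> 'a) \<Rightarrow> ('a \<Rightarrow> 'a) \<Rightarrow> bool" (infix "\<bottom>\<^sub>\<omega>\<^sub>B" 50)
  where "T \<bottom>\<^sub>\<omega>\<^sub>B S \<longleftrightarrow>
    (\<forall>c::complex. numerical_radius (\<lambda>x. T x + c *\<^sub>C S x) \<ge> numerical_radius T)"

end

theory Submission
  imports Defs
begin

text \<open>Testing \<^term>\<open>T \<bottom>\<^sub>\<omega>\<^sub>B S\<close> at the scalars \<open>\<epsilon> * cnj c\<close> with \<open>\<epsilon> \<rightarrow> 0\<close> and choosing near-maximal
  unit vectors up to \<open>\<epsilon>\<^sup>2\<close> yields a sequence \<open>x\<^sub>n\<close> along which \<open>\<bar>\<langle>T x\<^sub>n, x\<^sub>n\<rangle>\<bar>\<close> tends to the numerical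
  radius of \<open>T\<close>, while the real part of the cross term \<open>cnj \<langle>T x\<^sub>n, x\<^sub>n\<rangle> * cnj c * \<langle>S x\<^sub>n, x\<^sub>n\<rangle>\<close> is at
  least \<open>- O(\<epsilon>)\<close>. By hypothesis the same sequence is maximising for \<open>S\<close>, and the very same cross
  term appears in \<open>\<bar>\<langle>(S + c T) x\<^sub>n, x\<^sub>n\<rangle>\<bar>\<^sup>2\<close>, so the latter is asymptotically at least the square of
  the numerical radius of \<open>S\<close>. Only the quadratic forms enter, hence the argument is carried out
  for bounded complex-valued functions on a set.\<close>

lemma cmod_add_mult_power2:
  "(cmod (a + d * b))\<^sup>2 = (cmod a)\<^sup>2 + 2 * Re (cnj a * d * b) + (cmod d)\<^sup>2 * (cmod b)\<^sup>2"
  unfolding cmod_power2 by (simp add: power2_eq_square algebra_simps)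

lemma SUP_cmod_orthogonal_sym:
  fixes f g :: "'b \<Rightarrow> complex"
  assumes ne: "A \<noteq> {}"
    and bf: "bdd_above ((\<lambda>x. cmod (f x)) ` A)"
    and bg: "bdd_above ((\<lambda>x. cmod (g x)) ` A)"
    and max_seq: "\<And>x. (\<And>n. x n \<in> A) \<Longrightarrow>
      (\<lambda>n::nat. cmod (f (x n))) \<longlonglongrightarrow> (SUP x\<in>A. cmod (f x)) \<Longrightarrow>
      (\<lambda>n. cmod (g (x n))) \<longlonglongrightarrow> (SUP x\<in>A. cmod (g x))"
    and orth: "\<And>c. (SUP x\<in>A. cmod (f x + c * g x)) \<ge> (SUP x\<in>A. cmod (f x))"
  shows "(SUP x\<in>A. cmod (g x + c * f x)) \<ge> (SUP x\<in>A. cmod (g x))"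
proof -
  define F where "F = (SUP x\<in>A. cmod (f x))"
  define G where "G = (SUP x\<in>A. cmod (g x))"
  define M where "M = (SUP x\<in>A. cmod (g x + c * f x))"
  define e :: "nat \<Rightarrow> real" where "e n = inverse (real (Suc n))" for n
  have e0: "e n > 0" for n by (simp add: e_def)
  have elim: "e \<longlonglongrightarrow> 0" unfolding e_def by (rule LIMSEQ_inverse_real_of_nat)
  have leF: "cmod (f x) \<le> F" if "x \<in> A" for x
    unfolding F_def by (rule cSUP_upper[OF that bf])
  have leG: "cmod (g x) \<le> G" if "x \<in> A" for x
    unfolding G_def by (rule cSUP_upper[OF that bg])
  have bM: "bdd_above ((\<lambda>x. cmod (g x + c * f x)) ` A)"
  proof (rule bdd_aboveI2)
    fix x assume "x \<in> A"
    then show "cmod (g x + c * f x) \<le> G + cmod c * F"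
      using norm_triangle_ineq[of "g x" "c * f x"] leG[of x]
        mult_left_mono[OF leF, of x "cmod c"] by (simp add: norm_mult)
  qed
  have leM: "cmod (g x + c * f x) \<le> M" if "x \<in> A" for x
    unfolding M_def by (rule cSUP_upper[OF that bM])
  obtain x0 where "x0 \<in> A" using ne by blast
  then have F0: "F \<ge> 0" and M0: "M \<ge> 0"
    using order_trans[OF norm_ge_zero leF] order_trans[OF norm_ge_zero leM] by auto
  \<comment> \<open>By orthogonality the supremum at the scalar \<open>e n * cnj c\<close> is at
    least \<open>F\<close>. The slack is quadratic in \<open>e n\<close>, so it still vanishes in
    the limit after a later division by \<open>e n\<close>.\<close>
  have "\<exists>x\<in>A. cmod (f x + of_real (e n) * cnj c * g x) > F - (e n)\<^sup>2" for n
  proof (rule ccontr)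
    assume "\<not> ?thesis"
    then have "(SUP x\<in>A. cmod (f x + of_real (e n) * cnj c * g x)) \<le> F - (e n)\<^sup>2"
      by (intro cSUP_least[OF ne]) force
    then show False
      using orth[of "of_real (e n) * cnj c"] e0[of n] zero_less_power[OF e0, of n 2]
      unfolding F_def by linarith
  qed
  then obtain x where xA: "\<And>n. x n \<in> A"
    and x: "\<And>n. cmod (f (x n) + of_real (e n) * cnj c * g (x n)) > F - (e n)\<^sup>2"
    by metis
  \<comment> \<open>The perturbation has modulus at most \<open>e n * (cmod c * G)\<close>, which
    squeezes \<open>cmod (f (x n))\<close> to \<open>F\<close>.\<close>
  have lower: "F - (e n)\<^sup>2 - e n * (cmod c * G) \<le> cmod (f (x n))" for n
  proof -
    have "cmod (of_real (e n) * cnj c * g (x n)) \<le> e n * (cmod c * G)"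
      using e0[of n] leG[OF xA[of n]]
      by (simp add: norm_mult mult.assoc mult_left_mono)
    then show ?thesis
      using x[of n] norm_triangle_ineq[of "f (x n)" "of_real (e n) * cnj c * g (x n)"] by linarith
  qed
  have "(\<lambda>n. F - (e n)\<^sup>2 - e n * (cmod c * G)) \<longlonglongrightarrow> F - 0\<^sup>2 - 0 * (cmod c * G)"
    by (intro tendsto_intros elim)
  then have "(\<lambda>n. F - (e n)\<^sup>2 - e n * (cmod c * G)) \<longlonglongrightarrow> F"
    by simp
  then have "(\<lambda>n. cmod (f (x n))) \<longlonglongrightarrow> F"
    by (rule tendsto_sandwich[rotated 2, OF _ tendsto_const[of F]])
      (simp_all add: lower leF[OF xA])
  then have gG: "(\<lambda>n. cmod (g (x n))) \<longlonglongrightarrow> G"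
    using max_seq[of x] xA unfolding F_def G_def by blast
  \<comment> \<open>Second-order errors: \<open>2 * F\<close> comes from the slack, the rest from
    the quadratic term of the expanded square.\<close>
  define K where "K = 2 * F + (cmod c)\<^sup>2 * G\<^sup>2"
  have cross: "2 * Re (cnj (f (x n)) * cnj c * g (x n)) \<ge> - (e n * K)" for n
  proof -
    let ?a = "f (x n)" and ?b = "g (x n)"
    define r where "r = Re (cnj ?a * cnj c * ?b)"
    define m where "m = cmod (?a + of_real (e n) * cnj c * ?b)"
    \<comment> \<open>Expanding \<open>(m - F)\<^sup>2 \<ge> 0\<close> gives
      \<open>m\<^sup>2 \<ge> 2 * F * m - F\<^sup>2\<close>; this avoids squaring
      \<open>F - (e n)\<^sup>2\<close>, which may be negative.\<close>
    have "F * (F - (e n)\<^sup>2) \<le> F * m"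
      using x[of n] F0 unfolding m_def by (intro mult_left_mono) auto
    moreover have "(m - F)\<^sup>2 \<ge> 0" by simp
    ultimately have "F\<^sup>2 - 2 * F * (e n)\<^sup>2 \<le> m\<^sup>2"
      by (simp add: power2_eq_square algebra_simps)
    also have "m\<^sup>2 = (cmod ?a)\<^sup>2 + 2 * (e n * r)
        + (e n)\<^sup>2 * ((cmod c)\<^sup>2 * (cmod ?b)\<^sup>2)"
      unfolding m_def r_def cmod_add_mult_power2
      by (simp add: norm_mult power_mult_distrib algebra_simps)
    also have "\<dots> \<le> F\<^sup>2 + 2 * (e n * r) + (e n)\<^sup>2 * ((cmod c)\<^sup>2 * G\<^sup>2)"
      using leF[OF xA[of n]] leG[OF xA[of n]] e0[of n]
      by (intro add_mono mult_left_mono power_mono) auto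
    finally have "e n * (- (e n * K)) \<le> e n * (2 * r)"
      by (simp add: K_def power2_eq_square algebra_simps)
    then show ?thesis using e0[of n] by (simp only: mult_le_cancel_left_pos r_def)
  qed
  have "(cmod (g (x n)))\<^sup>2 - e n * K \<le> M\<^sup>2" for n
  proof -
    \<comment> \<open>The two products are complex conjugates; this is why the test scalars carry
      \<open>cnj c\<close>.\<close>
    have "Re (cnj (g (x n)) * c * f (x n)) = Re (cnj (f (x n)) * cnj c * g (x n))"
      by (simp add: algebra_simps)
    then have "(cmod (g (x n)))\<^sup>2 - e n * K \<le> (cmod (g (x n) + c * f (x n)))\<^sup>2"
      using cross[of n] mult_nonneg_nonneg[of "(cmod c)\<^sup>2" "(cmod (f (x n)))\<^sup>2"]
        zero_le_power2[of "cmod c"] zero_le_power2[of "cmod (f (x n))"]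
      unfolding cmod_add_mult_power2 by linarith
    also have "\<dots> \<le> M\<^sup>2" using leM[OF xA] by (intro power_mono) auto
    finally show ?thesis .
  qed
  moreover have "(\<lambda>n. (cmod (g (x n)))\<^sup>2 - e n * K) \<longlonglongrightarrow> G\<^sup>2 - 0 * K"
    by (intro tendsto_intros gG elim)
  ultimately have "G\<^sup>2 - 0 * K \<le> M\<^sup>2"
    by (meson LIMSEQ_le_const2)
  then have "G \<le> M"
    using power2_le_imp_le[OF _ M0] by simp
  then show ?thesis
    by (simp only: G_def M_def)
qed

lemma cinner_add_right: "cinner x (y + z) = cinner x y + cinner x (z :: 'a::complex_inner)"
  by (metis cinner_add_left cinner_commute complex_cnj_add)

lemma cinner_scaleC_right: "cinner x (c *\<^sub>C y) = cnj c * cinner x (y :: 'a::complex_inner)"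
  by (metis cinner_commute cinner_scaleC_left complex_cnj_mult)

lemma cinner_self: "cinner x x = of_real ((norm (x :: 'a::complex_inner))\<^sup>2)"
proof -
  have "Im (cinner x x) = 0"
    using arg_cong[OF cinner_commute[of x x], of Im] by simp
  then show ?thesis
    by (simp add: complex_eq_iff norm_eq_sqrt_cinner cinner_self_nonneg)
qed

lemma cinner_Cauchy_Schwarz: "cmod (cinner x y) \<le> norm x * norm (y :: 'a::complex_inner)"
proof (cases "y = 0")
  case True
  have "cinner x 0 + cinner x 0 = cinner x 0"
    by (simp flip: cinner_add_right)
  with True show ?thesis by simp
next
  case False
  define q where "q = cinner x y"
  define N where "N = (norm y)\<^sup>2"
  have N: "N > 0" using False by (simp add: N_def)
  \<comment> \<open>This \<open>d\<close> makes \<open>x + d *\<^sub>C y\<close> orthogonal to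
    \<open>y\<close>, hence of least norm.\<close>
  define d where "d = - q / of_real N"
  have "cinner (x + d *\<^sub>C y) (x + d *\<^sub>C y)
      = of_real ((norm x)\<^sup>2) + cnj d * q + d * cnj q + d * cnj d * of_real N"
    unfolding cinner_add_left cinner_add_right cinner_scaleC_left cinner_scaleC_right
      cinner_self[of x] cinner_self[of y] cinner_commute[of y x] q_def N_def
    by (simp add: algebra_simps)
  also have "\<dots> = of_real ((norm x)\<^sup>2) - q * cnj q / of_real N"
    using N by (simp add: d_def field_simps)
  also have "\<dots> = of_real ((norm x)\<^sup>2 - (cmod q)\<^sup>2 / N)"
    by (simp flip: complex_norm_square)
  finally have "0 \<le> (norm x)\<^sup>2 - (cmod q)\<^sup>2 / N"
    using cinner_self_nonneg[of "x + d *\<^sub>C y"] by simp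
  then have "(cmod q)\<^sup>2 \<le> (norm x * norm y)\<^sup>2"
    using N by (simp add: N_def field_simps power_mult_distrib)
  then show ?thesis
    unfolding q_def by (rule power2_le_imp_le) simp
qed

text \<open>Makes the suprema over the unit sphere genuine upper bounds, by Cauchy-Schwarz and the
  operator norm.\<close>

lemma bdd_above_numerical_range:
  assumes "bounded_clinear T"
  shows "bdd_above ((\<lambda>x. cmod (cinner (T x) x)) ` {x. norm x = 1})"
proof (rule bdd_aboveI2)
  fix x :: 'a assume "x \<in> {x. norm x = 1}"
  then show "cmod (cinner (T x) x) \<le> onorm T"
    using cinner_Cauchy_Schwarz[of "T x" x] onorm[of T x] assms
    by (auto simp: bounded_clinear_def)
qed

text \<open>One inclusion drives one implication; equality of the two sets gives the converse by
  exchanging \<open>T\<close> and \<open>S\<close>.\<close>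

lemma numerical_radius_Birkhoff_orthogonal_sym:
  fixes T S :: "'a::complex_inner \<Rightarrow> 'a"
  assumes "bounded_clinear T" and "bounded_clinear S"
    and sub: "numerical_radius_seqs T \<subseteq> numerical_radius_seqs S"
    and orth: "T \<bottom>\<^sub>\<omega>\<^sub>B S"
  shows "S \<bottom>\<^sub>\<omega>\<^sub>B T"
proof (cases "{x::'a. norm x = 1} = {}")
  \<comment> \<open>On the zero space every numerical radius is the same \<open>Sup {}\<close>, so
    the inequality is reflexivity.\<close>
  case True
  then show ?thesis
    unfolding numerical_radius_Birkhoff_orthogonal_def numerical_radius_def True by simp
next
  case False
  have "numerical_radius S \<le> numerical_radius (\<lambda>x. S x + c *\<^sub>C T x)" for c
    unfolding numerical_radius_def cinner_add_left cinner_scaleC_left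
  proof (rule SUP_cmod_orthogonal_sym[OF False])
    show "(\<lambda>n. cmod (cinner (S (x n)) (x n))) \<longlonglongrightarrow> (SUP x\<in>{x. norm x = 1}. cmod (cinner (S x) x))"
      if "\<And>n. x n \<in> {x. norm x = 1}"
        "(\<lambda>n. cmod (cinner (T (x n)) (x n))) \<longlonglongrightarrow> (SUP x\<in>{x. norm x = 1}. cmod (cinner (T x) x))"
      for x
      using that sub unfolding numerical_radius_seqs_def numerical_radius_def by blast
    show "(SUP x\<in>{x. norm x = 1}. cmod (cinner (T x) x))
        \<le> (SUP x\<in>{x. norm x = 1}. cmod (cinner (T x) x + c * cinner (S x) x))" for c
      using orth unfolding numerical_radius_Birkhoff_orthogonal_def numerical_radius_def
        cinner_add_left cinner_scaleC_left by blast
  qed (rule bdd_above_numerical_range[OF assms(1)] bdd_above_numerical_range[OF assms(2)])+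
  then show ?thesis
    unfolding numerical_radius_Birkhoff_orthogonal_def by blast
qed

theorem theorem2p6:
  fixes T S :: "'a::complex_hilbert_space \<Rightarrow> 'a"
  assumes "bounded_clinear T" and "bounded_clinear S"
    and "numerical_radius_seqs T = numerical_radius_seqs S"
  shows "T \<bottom>\<^sub>\<omega>\<^sub>B S \<longleftrightarrow> S \<bottom>\<^sub>\<omega>\<^sub>B T"
  using assms numerical_radius_Birkhoff_orthogonal_sym by blast

end
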